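(* Suppose that $(\mathbf{X}, d)$ is a proper geodesic space and $\Omega\subsetneq \mathbf{X}$ is a bounded domain. Let $R_\infty=\max_{x\in\overline{\Omega}}d(x,\partial\Omega)$, $\Lambda_\infty=1/R_\infty$, and $\mathcal{M}(\Omega)=\{x\in\Omega: d(x,\partial\Omega)=R_\infty\}$. Let $u_\infty:\overline{\Omega}\to\mathbb{R}$ be defined, for any $x\in\overline{\Omega}$, by $$u_\infty(x)=\inf\left\{u(x): u \text{ is a positive supersolution of } \min\{|\nabla u|-\Lambda_\infty u,\,-\Delta_\infty u\}=0 \text{ in } \Omega \text{ satisfying } u=\max_{\overline{\Omega}}u=1 \text{ on } \mathcal{M}(\Omega)\right\}.$$ Then $u_\infty$ is continuous in $\overline{\Omega}$ and is a positive solution of $\min\{|\nabla u|-\Lambda_\infty u,\,-\Delta_\infty u\}=0$ in $\Omega$ satisfying $u_\infty=0$ on $\partial\Omega$ and $u_\infty=\max_{\overline{\Omega}}u_\infty=1$ on $\mathcal{M}(\Omega)$.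
   Context: A metric space $(\mathbf{X},d)$ is a geodesic space if any $x,y\in\mathbf{X}$ are joined by a Lipschitz curve of length $d(x,y)$; it is proper if all closed balls $\overline{B_r(x)}$ are compact. $B_r(x)$ is the open metric ball. A domain is a nonempty connected open set; $d(x,E)=\min_{y\in E}d(x,y)$ for compact $E$. $\mathcal{O}\subset\subset\Omega$ means $\overline{\mathcal{O}}\subset\Omega$. $\infty$-superharmonic: a function $u:\Omega\to\mathbb{R}$ bounded from below is $\infty$-superharmonic in $\Omega$ if it satisfies comparison with cones from below: for any $\hat{x}\in\Omega$, $a\in\mathbb{R}$, $\kappa\le 0$ and any bounded open set $\mathcal{O}\subset\subset\Omega$ with $\hat{x}\in\Omega\setminus\mathcal{O}$, if $u\ge\phi$ on $\partial\mathcal{O}$, where $\phi=a+\kappa d(\hat{x},\cdot)$, then $u\ge\phi$ in $\overline{\mathcal{O}}$. (The same definition is used with $\Omega$ replaced by a ball $B_{r_0}(x_0)\subset\Omega$.) Subslope: for locally Lipschitz $u$, $|\nabla^-u|(x)=\limsup_{y\to x}\frac{\max\{u(x)-u(y),0\}}{d(x,y)}$. For $\lambda\in\mathbb{R}$ consider the equation $\min\{|\nabla u|-\lambda u,-\Delta_\infty u\}=0$ in $\Omega$; its meaning is given solely by the following definitions. Supersolution: a locally Lipschitz function $u$ in $\Omega$ which is $\infty$-superharmonic in $\Omega$ and satisfies $|\nabla^-u|\ge\lambda u$ everywhere in $\Omega$. Subsolution: a locally Lipschitz function $u$ in $\Omega$ such that whenever there exist $x_0\in\Omega$, small $r_0>0$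 and an $\infty$-superharmonic function $v$ in $B_{r_0}(x_0)\subset\Omega$ such that $u-v$ attains a strict local maximum at $x_0$, one has $$\lim_{r\to0+}\inf_{B_r(x_0)}|\nabla^-v|\le\lambda u(x_0).$$ Solution: a locally Lipschitz function in $\Omega$ that is both a supersolution and a subsolution. *)

theory Defs
  imports "HOL-Analysis.Analysis"
begin

section \<open>Geodesics\<close>

text \<open>The length of a curve over the unit interval is the supremum of the lengths of the polygonal
  chains through finitely many increasing parameter values.\<close>

definition curve_length :: "(real \<Rightarrow> 'a::metric_space) \<Rightarrow> ereal" where
  "curve_length \<gamma> =
     (SUP ts \<in> {ts. sorted ts \<and> set ts \<subseteq> {0..1}}.
        \<Sum>i<length ts - 1. ereal (dist (\<gamma> (ts ! i)) (\<gamma> (ts ! Suc i))))"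

definition joined_by_geodesic :: "'a::metric_space \<Rightarrow> 'a \<Rightarrow> bool" where
  "joined_by_geodesic x y \<longleftrightarrow>
     (\<exists>\<gamma> L. L-lipschitz_on {0..1} \<gamma> \<and> pathstart \<gamma> = x \<and> pathfinish \<gamma> = y \<and>
            curve_length \<gamma> = ereal (dist x y))"


section \<open>The equation \<open>min {|\<nabla>u| - \<lambda>u, -\<Delta>\<^sub>\<infinity> u} = 0\<close>\<close>

text \<open>Functions on a set are total functions whose values off that set are never used. Below,
  \<open>U\<close> and \<open>\<Omega>\<close> are always open.\<close>

definition locally_lipschitz_on :: "'a::metric_space set \<Rightarrow> ('a \<Rightarrow> real) \<Rightarrow> bool" where
  "locally_lipschitz_on U u \<longleftrightarrow> (\<forall>x\<in>U. \<exists>r>0. \<exists>L. L-lipschitz_on (ball x r \<inter> U) u)"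

definition infty_superharmonic_on :: "'a::metric_space set \<Rightarrow> ('a \<Rightarrow> real) \<Rightarrow> bool" where
  "infty_superharmonic_on U u \<longleftrightarrow>
     bdd_below (u ` U) \<and>
     (\<forall>xh\<in>U. \<forall>a \<kappa>. \<kappa> \<le> 0 \<longrightarrow>
        (\<forall>V. open V \<and> bounded V \<and> closure V \<subseteq> U \<and> xh \<notin> V \<longrightarrow>
             (\<forall>y\<in>frontier V. u y \<ge> a + \<kappa> * dist xh y) \<longrightarrow>
             (\<forall>y\<in>closure V. u y \<ge> a + \<kappa> * dist xh y)))"

definition subslope :: "('a::metric_space \<Rightarrow> real) \<Rightarrow> 'a \<Rightarrow> ereal" where
  "subslope u x = Limsup (at x) (\<lambda>y. ereal (max (u x - u y) 0 / dist x y))"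

definition supersolution :: "real \<Rightarrow> 'a::metric_space set \<Rightarrow> ('a \<Rightarrow> real) \<Rightarrow> bool" where
  "supersolution lam \<Omega> u \<longleftrightarrow>
     locally_lipschitz_on \<Omega> u \<and> infty_superharmonic_on \<Omega> u \<and>
     (\<forall>x\<in>\<Omega>. subslope u x \<ge> ereal (lam * u x))"

text \<open>The infimum over the ball is monotone in the radius, so that the limit below always exists in
  the extended reals.\<close>

definition subsolution :: "real \<Rightarrow> 'a::metric_space set \<Rightarrow> ('a \<Rightarrow> real) \<Rightarrow> bool" where
  "subsolution lam \<Omega> u \<longleftrightarrow>
     locally_lipschitz_on \<Omega> u \<and>
     (\<forall>x0\<in>\<Omega>. \<forall>r0>0. \<forall>v.
        ball x0 r0 \<subseteq> \<Omega> \<longrightarrow> infty_superharmonic_on (ball x0 r0) v \<longrightarrow>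
        (\<forall>\<^sub>F y in at x0. u y - v y < u x0 - v x0) \<longrightarrow>
        Lim (at_right 0) (\<lambda>r. INF x\<in>ball x0 r. subslope v x) \<le> ereal (lam * u x0))"

definition solution :: "real \<Rightarrow> 'a::metric_space set \<Rightarrow> ('a \<Rightarrow> real) \<Rightarrow> bool" where
  "solution lam \<Omega> u \<longleftrightarrow> supersolution lam \<Omega> u \<and> subsolution lam \<Omega> u"


section \<open>The principal eigenvalue and the Perron infimum\<close>

text \<open>For bounded \<open>\<Omega>\<close> in a proper space, \<open>closure \<Omega>\<close> and \<open>frontier \<Omega>\<close> are compact; the supremum, and
  the infimum inside \<^const>\<open>infdist\<close>, are then attained.\<close>

definition R_infty :: "'a::metric_space set \<Rightarrow> real" where
  "R_infty \<Omega> = (SUP x\<in>closure \<Omega>. infdist x (frontier \<Omega>))"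

definition Lambda_infty :: "'a::metric_space set \<Rightarrow> real" where
  "Lambda_infty \<Omega> = 1 / R_infty \<Omega>"

definition max_dist_set :: "'a::metric_space set \<Rightarrow> 'a set" where
  "max_dist_set \<Omega> = {x \<in> \<Omega>. infdist x (frontier \<Omega>) = R_infty \<Omega>}"

definition normalized_on :: "'a::metric_space set \<Rightarrow> ('a \<Rightarrow> real) \<Rightarrow> bool" where
  "normalized_on \<Omega> u \<longleftrightarrow>
     (\<forall>x\<in>max_dist_set \<Omega>. u x = 1 \<and> (\<forall>y\<in>closure \<Omega>. u y \<le> u x))"

text \<open>A competitor is a function on \<open>closure \<Omega>\<close> that is positive in \<open>\<Omega>\<close>. Its values on the boundary are
  only required to be nonnegative and at most 1; they must be bounded below for the infimum
  to be finite there, and 0 must be allowed, since the multiple \<open>\<Lambda>\<^sub>\<infinity> d(\<cdot>, \<partial>\<Omega>)\<close> of the distance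
  function is a competitor. No continuity up to the boundary is imposed. The class contains every
  competitor continuous on \<open>closure \<Omega>\<close>, for which nonnegativity on the boundary is automatic.\<close>

definition competitors :: "'a::metric_space set \<Rightarrow> ('a \<Rightarrow> real) set" where
  "competitors \<Omega> =
     {u. supersolution (Lambda_infty \<Omega>) \<Omega> u \<and> (\<forall>x\<in>\<Omega>. u x > 0) \<and>
         (\<forall>x\<in>frontier \<Omega>. u x \<ge> 0) \<and> normalized_on \<Omega> u}"

definition u_infty :: "'a::metric_space set \<Rightarrow> 'a \<Rightarrow> real" where
  "u_infty \<Omega> x = (INF u\<in>competitors \<Omega>. u x)"

end

theory Submission
  imports Defs
begin

text \<open>Everything rests on one reading of comparison with cones. On a small closed ball a bound
  \<open>u \<ge> b - k \<rho>\<close> on the sphere of radius \<open>\<rho>\<close> about \<open>y\<close>, together with \<open>u y \<ge> b\<close>, propagates to the cone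
  bound \<open>u \<ge> b - k d(y, \<cdot>)\<close> inside (\<open>superharmonic_cone_ball\<close>). Three consequences follow.
  An \<open>\<infinity>\<close>-superharmonic function is locally Lipschitz (\<open>superharmonic_locally_lipschitz\<close>). If its subslope
  at \<open>x\<close> is at least \<open>K > 0\<close>, then it falls by at least \<open>K \<rho>\<close> from \<open>x\<close> to some point of the sphere of
  radius \<open>\<rho>\<close>, for every closed ball of radius \<open>\<rho>\<close> about \<open>x\<close> in the domain
  (\<open>superharmonic_steepest_descent\<close>), so that the infinitesimal slope condition is equivalent
  to one at positive scale, which survives infima. Finally, for continuous functions cone propagation
  on small balls already implies comparison with all cones (\<open>superharmonic_of_local\<close>), so that
  \<open>\<infinity>\<close>-superharmonicity is local and may be checked for glued functions.

  The infimum is taken over a nonempty class, since \<open>\<Lambda>\<^sub>\<infinity> d(\<cdot>, \<partial>\<Omega>)\<close> belongs to it (\<open>D_competitor\<close>).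
  This competitor forces the boundary values \<open>0\<close> and the continuity at the boundary. Comparison with
  cones passes to infima, and so does descent at positive scale, so \<open>u\<^sub>\<infinity>\<close> is a supersolution; positivity
  spreads from the set \<open>\<M>(\<Omega>)\<close>, where \<open>u\<^sub>\<infinity> = 1\<close>, through the connected domain by a Harnack-type bound.

  For the subsolution property let \<open>u\<^sub>\<infinity> - v\<close> have a strict maximum at \<open>x\<^sub>0\<close>. If \<open>x\<^sub>0 \<in> \<M>(\<Omega>)\<close>, then
  \<open>u\<^sub>\<infinity> \<ge> 1 - d(x\<^sub>0, \<cdot>) / R\<^sub>\<infinity>\<close> near \<open>x\<^sub>0\<close>, and this cone bounds the subslope of \<open>v\<close> at \<open>x\<^sub>0\<close> by
  \<open>\<Lambda>\<^sub>\<infinity> = \<Lambda>\<^sub>\<infinity> u\<^sub>\<infinity>(x\<^sub>0)\<close>. If \<open>x\<^sub>0 \<notin> \<M>(\<Omega>)\<close> and the conclusion failed, then replacing \<open>u\<^sub>\<infinity>\<close> near \<open>x\<^sub>0\<close>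
  by its minimum with a vertical translate of \<open>v\<close> that passes just below \<open>u\<^sub>\<infinity>(x\<^sub>0)\<close> would give a competitor
  that is smaller than \<open>u\<^sub>\<infinity>\<close> at \<open>x\<^sub>0\<close>.\<close>


section \<open>Geodesics and exit points\<close>

locale proper_geodesic_space =
  fixes space :: "'a::metric_space itself"
  assumes geodesic: "joined_by_geodesic (x::'a) y"
    and proper: "compact (cball (x::'a) r)"
begin

text \<open>The chain through a single intermediate parameter already has length at most \<open>d(x, y)\<close>, so the
  triangle inequality is an equality at every point of a geodesic.\<close>

lemma geodesic_segment:
  fixes x y :: 'a
  obtains C where "connected C" "x \<in> C" "y \<in> C" "\<And>p. p \<in> C \<Longrightarrow> dist x p + dist p y = dist x y"
proof -
  obtain \<gamma> L where lip: "L-lipschitz_on {0..1} \<gamma>" and ends: "pathstart \<gamma> = x" "pathfinish \<gamma> = y"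
    and len: "curve_length \<gamma> = ereal (dist x y)"
    using geodesic[of x y] unfolding joined_by_geodesic_def by blast
  have between: "dist x (\<gamma> s) + dist (\<gamma> s) y = dist x y" if "s \<in> {0..1}" for s
  proof -
    have "(\<Sum>i<length [0,s,1] - 1. ereal (dist (\<gamma> ([0,s,1] ! i)) (\<gamma> ([0,s,1] ! Suc i))))
            \<le> curve_length \<gamma>"
      unfolding curve_length_def by (rule SUP_upper) (use that in auto)
    then have "dist x (\<gamma> s) + dist (\<gamma> s) y \<le> dist x y"
      using ends len by (simp add: pathstart_def pathfinish_def lessThan_Suc add.commute)
    then show ?thesis using dist_triangle[of x y "\<gamma> s"] by linarith
  qed
  show thesis
  proof
    show "connected (\<gamma> ` {0..1})"
      by (intro connected_continuous_image lipschitz_on_continuous_on[OF lip]) simp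
    show "x \<in> \<gamma> ` {0..1}" "y \<in> \<gamma> ` {0..1}"
      using ends by (auto simp: pathstart_def pathfinish_def)
    show "\<And>p. p \<in> \<gamma> ` {0..1} \<Longrightarrow> dist x p + dist p y = dist x y"
      using between by blast
  qed
qed

text \<open>All geometric arguments below use geodesics only through the point where they leave a set.\<close>

lemma exit_point:
  fixes x y :: 'a
  assumes "x \<in> V" "y \<notin> V"
  obtains z where "z \<in> frontier V" "dist x z + dist z y = dist x y"
proof -
  obtain C where C: "connected C" "x \<in> C" "y \<in> C" "\<And>p. p \<in> C \<Longrightarrow> dist x p + dist p y = dist x y"
    using geodesic_segment[of x y] by metis
  have "C \<inter> frontier V \<noteq> {}"
    using connected_Int_frontier[OF C(1), of V] C(2,3) assms by blast
  then show thesis using that C(4) by blast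
qed

lemma frontier_ball_subset_sphere: "frontier (ball (x::'a) r) \<subseteq> sphere x r"
proof -
  have "closure (ball x r) \<subseteq> cball x r"
    by (rule closure_minimal) auto
  then show ?thesis unfolding frontier_def by (auto simp: interior_open)
qed

lemma point_between:
  fixes x y :: 'a
  assumes "0 < t" "t \<le> dist x y"
  obtains z where "dist x z = t" "dist z y = dist x y - t"
proof -
  obtain z where "z \<in> frontier (ball x t)" "dist x z + dist z y = dist x y"
    using exit_point[of x "ball x t" y] assms by auto
  then show thesis using that[of z] frontier_ball_subset_sphere[of x t] by auto
qed

lemma compact_sphere: "compact (sphere (x::'a) r)"
proof -
  have "closed {z. dist x z = r}" by (intro closed_Collect_eq continuous_intros)
  moreover have "sphere x r = cball x r \<inter> {z. dist x z = r}" by auto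
  ultimately show ?thesis
    using compact_Int_closed[OF proper[of x r], of "{z. dist x z = r}"] by simp
qed

lemma compact_of_closed_bounded:
  fixes S :: "'a set"
  assumes "closed S" "bounded S"
  shows "compact S"
proof -
  obtain x e where "S \<subseteq> cball x e" using assms(2) unfolding bounded_def by (auto simp: subset_iff)
  then have "S = cball x e \<inter> S" by auto
  then show ?thesis using compact_Int_closed[OF proper[of x e] assms(1)] by simp
qed

end

section \<open>Comparison with cones on balls\<close>

text \<open>The cone with vertex at the centre of the ball and any height \<open>b\<close> up to the value at the
  vertex. Leaving \<open>b\<close> free, instead of fixing it to be \<open>w y\<close>, makes the property stable under minima.\<close>
definition cone_ball :: "('a::metric_space \<Rightarrow> real) \<Rightarrow> 'a \<Rightarrow> real \<Rightarrow> bool" where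
  "cone_ball w y \<rho> \<longleftrightarrow>
     (\<forall>b k. 0 \<le> k \<longrightarrow> b \<le> w y \<longrightarrow> (\<forall>z\<in>sphere y \<rho>. b - k * \<rho> \<le> w z) \<longrightarrow>
            (\<forall>z\<in>ball y \<rho>. b - k * dist y z \<le> w z))"

lemma cone_ballD:
  assumes "cone_ball w y \<rho>" "0 \<le> k" "b \<le> w y" "\<And>z. z \<in> sphere y \<rho> \<Longrightarrow> b - k * \<rho> \<le> w z"
    "z \<in> ball y \<rho>"
  shows "b - k * dist y z \<le> w z"
  using assms unfolding cone_ball_def by blast

lemma cone_ball_min:
  assumes "cone_ball u y \<rho>" "cone_ball v y \<rho>"
    and w: "\<And>z. z \<in> cball y \<rho> \<Longrightarrow> w z = min (u z) (v z)"
  shows "cone_ball w y \<rho>"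
  unfolding cone_ball_def
proof (intro allI impI ballI)
  fix b k z
  assume a: "0 \<le> k" "b \<le> w y" "\<forall>z\<in>sphere y \<rho>. b - k * \<rho> \<le> w z" and z: "z \<in> ball y \<rho>"
  have rho: "0 < \<rho>" using z by (metis ball_empty empty_iff not_less)
  have y: "w y = min (u y) (v y)" by (rule w) (use rho in auto)
  have s: "w z = min (u z) (v z)" if "z \<in> sphere y \<rho>" for z by (rule w) (use that in auto)
  have "b - k * dist y z \<le> u z"
    by (rule cone_ballD[OF assms(1) a(1) _ _ z]) (use a s y in force)+
  moreover have "b - k * dist y z \<le> v z"
    by (rule cone_ballD[OF assms(2) a(1) _ _ z]) (use a s y in force)+
  ultimately show "b - k * dist y z \<le> w z" using w[of z] z by auto
qed

lemma cone_ball_cong: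
  assumes "cone_ball u y \<rho>" and "\<And>z. z \<in> cball y \<rho> \<Longrightarrow> w z = u z"
  shows "cone_ball w y \<rho>"
  using cone_ball_min[OF assms(1,1)] assms(2) by simp

lemma superharmonicD:
  assumes "infty_superharmonic_on U u" "xh \<in> U" "\<kappa> \<le> 0"
    "open V" "bounded V" "closure V \<subseteq> U" "xh \<notin> V"
    "\<And>y. y \<in> frontier V \<Longrightarrow> a + \<kappa> * dist xh y \<le> u y" "y \<in> closure V"
  shows "a + \<kappa> * dist xh y \<le> u y"
  using assms unfolding infty_superharmonic_on_def by blast

lemma superharmonic_subset:
  assumes "infty_superharmonic_on U u" "W \<subseteq> U"
  shows "infty_superharmonic_on W u"
proof -
  have "bdd_below (u ` W)"
    using assms bdd_below_mono image_mono unfolding infty_superharmonic_on_def by metis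
  then show ?thesis
    using assms unfolding infty_superharmonic_on_def by (meson order_trans subsetD)
qed

lemma superharmonic_add_const:
  assumes "infty_superharmonic_on U u"
  shows "infty_superharmonic_on U (\<lambda>y. u y + c)"
proof -
  obtain m where m: "\<And>y. y \<in> U \<Longrightarrow> m \<le> u y"
    using assms unfolding infty_superharmonic_on_def bdd_below_def by (metis imageI)
  have "bdd_below ((\<lambda>y. u y + c) ` U)"
    using m by (auto intro!: bdd_belowI[of _ "m + c"])
  moreover have "a + \<kappa> * dist xh y \<le> u y + c"
    if "xh \<in> U" "\<kappa> \<le> 0" "open V" "bounded V" "closure V \<subseteq> U" "xh \<notin> V"
      "\<forall>y\<in>frontier V. a + \<kappa> * dist xh y \<le> u y + c" "y \<in> closure V" for xh a \<kappa> V y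
  proof -
    have "(a - c) + \<kappa> * dist xh y \<le> u y"
      by (rule superharmonicD[OF assms that(1-6) _ that(8)]) (use that(7) in force)
    then show ?thesis by simp
  qed
  ultimately show ?thesis unfolding infty_superharmonic_on_def by blast
qed

text \<open>This is comparison on the punctured ball, whose frontier lies in the union of the centre and the
  sphere; the puncture is what admits the centre as a vertex.\<close>

lemma superharmonic_cone_ball:
  assumes u: "infty_superharmonic_on U u" and sub: "cball y \<rho> \<subseteq> U"
  shows "cone_ball u y \<rho>"
  unfolding cone_ball_def
proof (intro allI impI ballI)
  fix b k z
  assume k: "0 \<le> k" and b: "b \<le> u y" and s: "\<forall>z\<in>sphere y \<rho>. b - k * \<rho> \<le> u z"
    and z: "z \<in> ball y \<rho>"
  let ?V = "ball y \<rho> - {y}"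
  have rho: "0 < \<rho>" using z by (metis ball_empty empty_iff not_less)
  have cl: "closure ?V \<subseteq> cball y \<rho>" by (rule closure_minimal) auto
  have op: "open ?V" by (intro open_delete open_ball)
  have fr: "frontier ?V \<subseteq> insert y (sphere y \<rho>)"
    using cl op by (auto simp: frontier_def interior_open)
  show "b - k * dist y z \<le> u z"
  proof (cases "z = y")
    case True
    then show ?thesis using b by simp
  next
    case False
    have "b + (- k) * dist y z \<le> u z"
    proof (rule superharmonicD[OF u _ _ op])
      show "y \<in> U" using sub rho by auto
      show "bounded ?V" by (rule bounded_subset[OF bounded_ball]) auto
      show "closure ?V \<subseteq> U" using cl sub by auto
      show "z \<in> closure ?V" using False z closure_subset[of ?V] by auto
      show "b + - k * dist y p \<le> u p" if "p \<in> frontier ?V" for p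
        using that fr b s by (auto simp: dist_commute)
    qed (use k in auto)
    then show ?thesis by simp
  qed
qed

text \<open>A Harnack-type estimate: on a sphere of radius \<open>\<rho>\<close> the function is at least its lower bound \<open>m\<close>, and
  the cone joining the value at the centre to \<open>m\<close> is a lower barrier.\<close>

lemma superharmonic_drop:
  assumes u: "infty_superharmonic_on U u" and sub: "cball y \<rho> \<subseteq> U"
    and m: "\<And>z. z \<in> U \<Longrightarrow> m \<le> u z" and z: "z \<in> ball y \<rho>"
  shows "u y - (u y - m) / \<rho> * dist y z \<le> u z"
proof (rule cone_ballD[OF superharmonic_cone_ball[OF u sub] _ order_refl _ z])
  have rho: "0 < \<rho>" using z by (metis ball_empty empty_iff not_less)
  then have y: "y \<in> U" using sub by auto
  then show "0 \<le> (u y - m) / \<rho>" using rho m by simp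
  show "u y - (u y - m) / \<rho> * \<rho> \<le> u p" if "p \<in> sphere y \<rho>" for p
    using m[of p] that rho sub by (auto simp: subset_iff)
qed

text \<open>The drop estimate bounds differences by a slope that depends on the value at the base point. Applied
  from nearby points back to \<open>x\<close>, it also bounds the values near \<open>x\<close> from above, which makes that slope
  uniform.\<close>

lemma superharmonic_locally_lipschitz:
  assumes U: "open U" and u: "infty_superharmonic_on U u"
  shows "locally_lipschitz_on U u"
  unfolding locally_lipschitz_on_def
proof
  fix x assume x: "x \<in> U"
  obtain m where m: "\<And>y. y \<in> U \<Longrightarrow> m \<le> u y"
    using u unfolding infty_superharmonic_on_def bdd_below_def by (metis imageI)
  obtain r' where r': "r' > 0" "ball x r' \<subseteq> U" using U x openE by blast
  define r where "r = r' / 4"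
  have r: "r > 0" and sub: "ball x (4 * r) \<subseteq> U" using r' by (auto simp: r_def)
  have cb: "cball y (2 * r) \<subseteq> U" if "y \<in> ball x r" for y
  proof
    fix z assume "z \<in> cball y (2 * r)"
    then have "z \<in> ball x (4 * r)" using that dist_triangle[of x z y] r by auto
    then show "z \<in> U" using sub by auto
  qed
  define L where "L = (u x - m) / r"
  have L: "0 \<le> L" using m[OF x] r by (simp add: L_def)
  have slope: "(u y - m) / (2 * r) \<le> L" if y: "y \<in> ball x r" for y
  proof -
    have "u y - (u y - m) / (2 * r) * dist y x \<le> u x"
      by (rule superharmonic_drop[OF u cb[OF y] m]) (use y r in \<open>auto simp: dist_commute\<close>)
    moreover have "(u y - m) / (2 * r) * dist y x \<le> (u y - m) / (2 * r) * r"
      using y r m[of y] cb[OF y] by (intro mult_left_mono) (auto simp: dist_commute subset_iff)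
    moreover have "(u y - m) / (2 * r) * r = (u y - m) / 2" using r by simp
    ultimately have "(u y - m) / 2 \<le> u x - m" by argo
    then have "(u y - m) / 2 / r \<le> L" unfolding L_def using r by (intro divide_right_mono) auto
    then show ?thesis by simp
  qed
  have half: "u y - u z \<le> L * dist y z" if y: "y \<in> ball x r" and z: "z \<in> ball x r" for y z
  proof -
    have "z \<in> ball y (2 * r)" using y z dist_triangle[of y z x] by (auto simp: dist_commute)
    then have "u y - (u y - m) / (2 * r) * dist y z \<le> u z"
      by (rule superharmonic_drop[OF u cb[OF y] m, rotated])
    moreover have "(u y - m) / (2 * r) * dist y z \<le> L * dist y z"
      using slope[OF y] by (rule mult_right_mono) simp
    ultimately show ?thesis by linarith
  qed
  have "L-lipschitz_on (ball x r) u"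
  proof (rule lipschitz_onI[OF _ L])
    fix y z assume "y \<in> ball x r" "z \<in> ball x r"
    then show "dist (u y) (u z) \<le> L * dist y z"
      using half[of y z] half[of z y] by (auto simp: dist_real_def dist_commute abs_le_iff)
  qed
  then show "\<exists>r>0. \<exists>L. L-lipschitz_on (ball x r \<inter> U) u"
    using r lipschitz_on_subset[of _ "ball x r" u "ball x r \<inter> U"] by blast
qed

lemma locally_lipschitz_continuous_on:
  assumes "locally_lipschitz_on U u" "open U"
  shows "continuous_on U u"
proof (rule continuous_at_imp_continuous_on, rule ballI)
  fix x assume x: "x \<in> U"
  obtain r L where r: "r > 0" "L-lipschitz_on (ball x r \<inter> U) u"
    using assms(1) x unfolding locally_lipschitz_on_def by blast
  have "continuous_on (ball x r \<inter> U) u" using lipschitz_on_continuous_on[OF r(2)] .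
  moreover have "open (ball x r \<inter> U)" "x \<in> ball x r \<inter> U" using assms(2) r x by auto
  ultimately show "isCont u x" by (metis continuous_on_eq_continuous_at)
qed

lemma superharmonic_continuous_on:
  assumes "open U" "infty_superharmonic_on U u"
  shows "continuous_on U u"
  using locally_lipschitz_continuous_on[OF superharmonic_locally_lipschitz[OF assms] assms(1)] .

section \<open>Steepest descent and the subslope\<close>

lemma subslope_le:
  assumes "0 < r" "0 \<le> k" and le: "\<And>z. z \<in> ball x r \<Longrightarrow> u x - k * dist x z \<le> u z"
  shows "subslope u x \<le> ereal k"
  unfolding subslope_def
proof (rule Limsup_bounded)
  have "\<forall>\<^sub>F y in at x. y \<in> ball x r \<and> y \<noteq> x"
    using assms(1) by (auto simp: eventually_at dist_commute intro!: exI[of _ r])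
  then show "\<forall>\<^sub>F y in at x. ereal (max (u x - u y) 0 / dist x y) \<le> ereal k"
  proof eventually_elim
    case (elim y)
    then have "max (u x - u y) 0 \<le> k * dist x y"
      using le[of y] assms(2) by auto
    then show ?case using elim assms(2) by (simp add: divide_le_eq)
  qed
qed

lemma subslope_ge:
  assumes "0 < r" and drop: "\<And>\<rho>. 0 < \<rho> \<Longrightarrow> \<rho> < r \<Longrightarrow> \<exists>z\<in>sphere x \<rho>. u z \<le> u x - K * \<rho>"
  shows "ereal K \<le> subslope u x"
proof (rule ccontr)
  assume "\<not> ?thesis"
  then have "\<forall>\<^sub>F y in at x. ereal (max (u x - u y) 0 / dist x y) < ereal K"
    unfolding subslope_def by (intro Limsup_lessD) simp
  then obtain d where d: "d > 0"
    "\<And>y. y \<noteq> x \<Longrightarrow> dist y x < d \<Longrightarrow> max (u x - u y) 0 / dist x y < K"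
    unfolding eventually_at by auto
  define \<rho> where "\<rho> = min d r / 2"
  have \<rho>: "0 < \<rho>" "\<rho> < r" "\<rho> < d" using d(1) assms(1) by (auto simp: \<rho>_def)
  obtain z where z: "dist x z = \<rho>" "u z \<le> u x - K * \<rho>" using drop[OF \<rho>(1,2)] by auto
  have "max (u x - u z) 0 / \<rho> < K"
    using d(2)[of z] z \<rho> by (auto simp: dist_commute)
  then have "u x - u z < K * \<rho>" using \<rho> by (simp add: divide_less_eq)
  then show False using z by simp
qed

lemma subslope_mono:
  assumes "u x = v x" "\<forall>\<^sub>F y in at x. u y \<le> v y"
  shows "subslope v x \<le> subslope u x"
  unfolding subslope_def using assms
  by (intro Limsup_mono) (auto elim!: eventually_mono intro!: divide_right_mono)

text \<open>The infimum over the ball grows as the radius shrinks, so the limit is the supremum over all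
  radii.\<close>

lemma Lim_INF_ball_le:
  assumes "\<And>r. 0 < r \<Longrightarrow> (INF x\<in>ball x0 r. g x) \<le> (C::ereal)"
  shows "Lim (at_right 0) (\<lambda>r. INF x\<in>ball x0 r. g x) \<le> C"
proof -
  define f where "f r = (INF x\<in>ball x0 r. g x)" for r
  have anti: "f r' \<le> f r" if "r \<le> r'" for r r'
    unfolding f_def by (rule INF_superset_mono) (use that in auto)
  have "(f \<longlongrightarrow> (SUP r\<in>{0<..}. f r)) (at_right 0)"
  proof (rule order_tendstoI)
    fix a assume "a < (SUP r\<in>{0<..}. f r)"
    then obtain r where r: "0 < r" "a < f r" by (auto simp: less_SUP_iff)
    then have "\<forall>y>0. y < r \<longrightarrow> a < f y" using anti by (meson less_imp_le less_le_trans)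
    then show "\<forall>\<^sub>F r in at_right 0. a < f r"
      unfolding eventually_at_right_field using r by blast
  next
    fix a assume a: "(SUP r\<in>{0<..}. f r) < a"
    have "f y < a" if "0 < y" for y
      using SUP_upper[of y "{0<..}" f] that a by auto
    then show "\<forall>\<^sub>F r in at_right 0. f r < a"
      unfolding eventually_at_right_field by (meson zero_less_one)
  qed
  then have "Lim (at_right 0) f = (SUP r\<in>{0<..}. f r)" by (intro tendsto_Lim) auto
  also have "\<dots> \<le> C" by (rule SUP_least) (use assms f_def in auto)
  finally show ?thesis by (simp add: f_def[abs_def])
qed

context proper_geodesic_space
begin

text \<open>A strict gap over the compact sphere leaves room to lower the slope of the barrier.\<close>

lemma cone_ball_gap:
  fixes y :: 'a
  assumes cb: "cone_ball w y \<rho>" and cont: "continuous_on (sphere y \<rho>) w"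
    and "0 < \<rho>" "0 < K" and gap: "\<And>z. z \<in> sphere y \<rho> \<Longrightarrow> w y - K * \<rho> < w z"
  obtains k where "0 \<le> k" "k < K" "\<And>z. z \<in> ball y \<rho> \<Longrightarrow> w y - k * dist y z \<le> w z"
proof -
  have "\<exists>k. 0 \<le> k \<and> k < K \<and> (\<forall>z\<in>sphere y \<rho>. w y - k * \<rho> \<le> w z)"
  proof (cases "sphere y \<rho> = {}")
    case True
    then show ?thesis using assms by (intro exI[of _ 0]) auto
  next
    case False
    then obtain z0 where z0: "z0 \<in> sphere y \<rho>" "\<And>z. z \<in> sphere y \<rho> \<Longrightarrow> w z0 \<le> w z"
      using continuous_attains_inf[OF compact_sphere False cont] by blast
    define k where "k = max 0 ((w y - w z0) / \<rho>)"
    have "k < K" using gap[OF z0(1)] assms by (auto simp: k_def divide_less_eq)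
    moreover have "(w y - w z0) / \<rho> * \<rho> \<le> k * \<rho>"
      using assms by (intro mult_right_mono) (auto simp: k_def)
    then have "w y - k * \<rho> \<le> w z0" using assms by simp
    then have "\<forall>z\<in>sphere y \<rho>. w y - k * \<rho> \<le> w z" using z0(2) by force
    ultimately show ?thesis by (intro exI[of _ k]) (auto simp: k_def)
  qed
  then show thesis
    using that cone_ballD[OF cb _ order_refl] by (metis (no_types, lifting))
qed

text \<open>Otherwise a cone of slope less than \<open>K\<close> would lie below \<open>u\<close> on the ball and touch it at \<open>x\<close>, which
  bounds the subslope by that smaller slope.\<close>

lemma superharmonic_steepest_descent:
  fixes x :: 'a
  assumes "open U" "infty_superharmonic_on U u" "cball x \<rho> \<subseteq> U" "0 < \<rho>" "0 < K"
    and slope: "ereal K \<le> subslope u x"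
  shows "\<exists>z\<in>sphere x \<rho>. u z \<le> u x - K * \<rho>"
proof (rule ccontr)
  assume *: "\<not> ?thesis"
  have "continuous_on (sphere x \<rho>) u"
    by (rule continuous_on_subset[OF superharmonic_continuous_on[OF assms(1,2)]])
      (use assms(3) in auto)
  then obtain k where k: "0 \<le> k" "k < K" "\<And>z. z \<in> ball x \<rho> \<Longrightarrow> u x - k * dist x z \<le> u z"
    by (rule cone_ball_gap[OF superharmonic_cone_ball[OF assms(2,3)] _ assms(4,5)])
      (use * in \<open>auto simp: not_le\<close>)
  have "subslope u x \<le> ereal k" by (rule subslope_le[OF assms(4) k(1,3)])
  then show False using slope k(2) by (metis ereal_less_eq(3) not_less order_trans)
qed

section \<open>Comparison with cones is a local property\<close>

text \<open>Suppose that \<open>w\<close> minus the cone has a negative minimum over the closure, and choose the minimum point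
  \<open>x\<close> farthest from the vertex \<open>xh\<close>. Move from \<open>x\<close> a distance \<open>t\<close> towards the vertex, to \<open>y\<close>. The
  function rises from \<open>x\<close> to \<open>y\<close> at some rate \<open>K \<ge> h\<close>, so the cone property on the ball of radius \<open>2 t\<close>
  about \<open>y\<close> gives a point \<open>z\<close> of its sphere to which \<open>w\<close> falls at rate at least \<open>K\<close>. Minimality at
  \<open>x\<close> then makes \<open>z\<close> another minimum point, farther from the vertex by \<open>t\<close>. Positivity of \<open>h\<close>
  makes \<open>K\<close> positive, as the descent to \<open>z\<close> requires.\<close>

lemma cone_comparison_of_local:
  fixes V :: "'a set"
  assumes V: "open V" "bounded V" and cont: "continuous_on (closure V) w"
    and loc: "\<And>x. x \<in> V \<Longrightarrow> \<exists>r>0. \<forall>y\<in>ball x r. \<forall>\<rho>. 0 < \<rho> \<longrightarrow> \<rho> < r \<longrightarrow> cone_ball w y \<rho>"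
    and xh: "xh \<notin> V" and h: "0 < h"
    and bd: "\<And>y. y \<in> frontier V \<Longrightarrow> a - h * dist xh y \<le> w y"
    and p: "p \<in> closure V"
  shows "a - h * dist xh p \<le> w p"
proof (rule ccontr)
  assume neg: "\<not> ?thesis"
  define f where "f y = w y - (a - h * dist xh y)" for y
  have fcont: "continuous_on (closure V) f"
    unfolding f_def using cont by (intro continuous_intros)
  have comp: "compact (closure V)"
    using V by (intro compact_of_closed_bounded) auto
  obtain q where q: "q \<in> closure V" "\<And>y. y \<in> closure V \<Longrightarrow> f q \<le> f y"
    using continuous_attains_inf[OF comp _ fcont] p by (metis empty_iff)
  have fq: "f q < 0" using q(2)[OF p] neg by (simp add: f_def)
  define F where "F = {y \<in> closure V. f y = f q}"
  have "closed F"
    unfolding F_def by (intro continuous_closed_preimage_constant[OF fcont]) simp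
  then have "compact F"
    using compact_Int_closed[OF comp, of F] by (simp add: F_def Int_absorb1 Collect_restrict)
  moreover have "continuous_on F (\<lambda>y. dist xh y)" by (intro continuous_intros)
  moreover have "F \<noteq> {}" using q by (auto simp: F_def)
  ultimately obtain x where x: "x \<in> F" "\<And>y. y \<in> F \<Longrightarrow> dist xh y \<le> dist xh x"
    using continuous_attains_sup[of F "\<lambda>y. dist xh y"] by metis
  have "x \<notin> frontier V" using bd[of x] x(1) fq by (auto simp: F_def f_def)
  then have xV: "x \<in> V" using x(1) V(1) by (auto simp: F_def frontier_def interior_open)
  obtain r1 where r1: "r1 > 0" "\<And>y \<rho>. y \<in> ball x r1 \<Longrightarrow> 0 < \<rho> \<Longrightarrow> \<rho> < r1 \<Longrightarrow> cone_ball w y \<rho>"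
    using loc[OF xV] by blast
  obtain r2 where r2: "r2 > 0" "ball x r2 \<subseteq> V" using V(1) xV openE by blast
  \<comment> \<open>The factor 4 leaves room for the ball of radius \<open>2 t\<close> about a point at distance \<open>t\<close> from \<open>x\<close>.\<close>
  define t where "t = min (min r1 r2 / 4) (dist xh x)"
  have "x \<noteq> xh" using xh xV by auto
  then have t: "0 < t" "t \<le> dist x xh" "4 * t \<le> r1" "4 * t \<le> r2"
    using r1 r2 by (auto simp: t_def dist_commute)
  obtain y where y: "dist x y = t" "dist y xh = dist x xh - t" using point_between[OF t(1,2)] .
  have cbV: "cball y (2 * t) \<subseteq> V"
  proof
    fix z assume "z \<in> cball y (2 * t)"
    then have "z \<in> ball x r2" using dist_triangle[of x z y] y t by auto
    then show "z \<in> V" using r2 by auto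
  qed
  have clV: "V \<subseteq> closure V" by (rule closure_subset)
  have yV: "y \<in> V" using cbV t by auto
  define K where "K = (w y - w x) / t"
  have Kt: "w y = w x + K * t" using t by (simp add: K_def)
  have fx: "w x = f q + a - h * dist xh x" using x(1) by (simp add: F_def f_def)
  have dy: "dist xh y = dist xh x - t" using y by (simp add: dist_commute)
  have "f q \<le> f y" using q(2) yV clV by blast
  then have "f q \<le> w y - a + h * (dist xh x - t)" by (simp add: f_def dy)
  then have "h * t \<le> K * t" using fx Kt by (simp add: algebra_simps)
  then have K: "h \<le> K" using t by simp
  have "\<exists>z\<in>sphere y (2 * t). w z \<le> w y - K * (2 * t)"
  proof (rule ccontr)
    assume *: "\<not> ?thesis"
    have cb: "cone_ball w y (2 * t)" by (rule r1(2)) (use y t in auto)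
    have sc: "continuous_on (sphere y (2 * t)) w"
      using continuous_on_subset[OF cont] cbV clV sphere_cball[of y "2 * t"] by blast
    obtain k where k: "0 \<le> k" "k < K" "\<And>z. z \<in> ball y (2 * t) \<Longrightarrow> w y - k * dist y z \<le> w z"
      by (rule cone_ball_gap[OF cb sc, of K]) (use * t K h in \<open>auto simp: not_le\<close>)
    have "w y - k * t \<le> w x" using k(3)[of x] y t by (simp add: dist_commute)
    moreover have "k * t < K * t" using k t by simp
    ultimately show False using Kt by linarith
  qed
  then obtain z where z: "dist y z = 2 * t" "w z \<le> w y - K * (2 * t)" by auto
  have "z \<in> V" using z cbV by auto
  then have zV: "z \<in> closure V" using clV by blast
  have dz: "dist xh z \<le> dist xh y + 2 * t" using dist_triangle[of xh z y] z by simp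
  have fz: "f q \<le> f z" using q(2)[OF zV] .
  have "h * t \<le> K * t" using K t by simp
  then have up: "w z \<le> w x - h * t" using z(2) Kt by (simp add: algebra_simps)
  have "h * (dist xh x + t) \<le> h * dist xh z"
    using fz[unfolded f_def[of z]] up fx by (simp add: algebra_simps)
  then have far: "dist xh x + t \<le> dist xh z" using h by simp
  then have "h * (dist xh x + t) = h * dist xh z"
    using dz y by (simp add: dist_commute)
  then have "f z \<le> f q" using up fx unfolding f_def[of z] by (simp add: algebra_simps)
  then have "z \<in> F" using zV fz by (simp add: F_def)
  then show False using x(2)[of z] far t by simp
qed

text \<open>Cones of slope \<open>0\<close> are limits of strictly sloping ones with the same vertex.\<close>

lemma superharmonic_of_local:
  fixes U :: "'a set"
  assumes bdd: "bdd_below (w ` U)" and cont: "continuous_on U w"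
    and loc: "\<And>x. x \<in> U \<Longrightarrow> \<exists>r>0. \<forall>y\<in>ball x r. \<forall>\<rho>. 0 < \<rho> \<longrightarrow> \<rho> < r \<longrightarrow> cone_ball w y \<rho>"
  shows "infty_superharmonic_on U w"
  unfolding infty_superharmonic_on_def
proof (intro conjI ballI allI impI bdd)
  fix xh a \<kappa> V p
  assume xh: "xh \<in> U" and \<kappa>: "\<kappa> \<le> (0::real)"
    and V: "open V \<and> bounded V \<and> closure V \<subseteq> U \<and> xh \<notin> V"
    and bd: "\<forall>y\<in>frontier V. a + \<kappa> * dist xh y \<le> w y" and p: "p \<in> closure V"
  have steep: "a - (- \<kappa> + e) * dist xh p \<le> w p" if e: "0 < e" for e
  proof (rule cone_comparison_of_local[OF _ _ _ _ _ _ _ p])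
    show "continuous_on (closure V) w" using V cont continuous_on_subset by blast
    show "\<exists>r>0. \<forall>y\<in>ball x r. \<forall>\<rho>. 0 < \<rho> \<longrightarrow> \<rho> < r \<longrightarrow> cone_ball w y \<rho>" if "x \<in> V" for x
      using loc[of x] V that closure_subset[of V] by blast
    show "a - (- \<kappa> + e) * dist xh y \<le> w y" if "y \<in> frontier V" for y
    proof -
      have "0 \<le> e * dist xh y" using e by simp
      moreover have "a + \<kappa> * dist xh y \<le> w y" using bd that by blast
      ultimately show ?thesis by (simp add: algebra_simps)
    qed
  qed (use V \<kappa> e in auto)
  have "((\<lambda>e. a - (- \<kappa> + e) * dist xh p) \<longlongrightarrow> a - (- \<kappa> + 0) * dist xh p) (at_right 0)"
    by (intro tendsto_intros)
  then have "a - (- \<kappa> + 0) * dist xh p \<le> w p"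
    by (rule tendsto_upperbound) (use steep in \<open>auto simp: eventually_at_filter\<close>)
  then show "a + \<kappa> * dist xh p \<le> w p" by simp
qed

text \<open>By locality it suffices that each point has a neighbourhood in which the glued function is either the
  minimum of the two given functions or equal to \<open>u\<close>; the annulus where \<open>u \<le> v\<close> provides the overlap.
  Locality also bridges the gap between the cones for \<open>v\<close>, whose vertices lie in the ball, and those for
  the glued function, whose vertices may lie anywhere in \<open>U\<close>.\<close>

lemma superharmonic_glue:
  fixes x0 :: 'a
  assumes U: "open U" and u: "infty_superharmonic_on U u"
    and v: "infty_superharmonic_on (ball x0 s) v" and sub: "ball x0 s \<subseteq> U" and s: "0 < s"
    and le: "\<And>y. y \<in> ball x0 s \<Longrightarrow> s / 2 \<le> dist x0 y \<Longrightarrow> u y \<le> v y"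
  shows "infty_superharmonic_on U (\<lambda>y. if y \<in> ball x0 s then min (u y) (v y) else u y)"
    (is "infty_superharmonic_on U ?w")
proof (rule superharmonic_of_local)
  have inside: "?w y = min (u y) (v y)" if "y \<in> ball x0 s" for y using that by simp
  have outside: "?w y = u y" if "s / 2 \<le> dist x0 y" for y using le[of y] that by auto
  obtain m where m: "\<And>y. y \<in> U \<Longrightarrow> m \<le> u y"
    using u unfolding infty_superharmonic_on_def bdd_below_def by (metis imageI)
  obtain n where n: "\<And>y. y \<in> ball x0 s \<Longrightarrow> n \<le> v y"
    using v unfolding infty_superharmonic_on_def bdd_below_def by (metis imageI)
  show "bdd_below (?w ` U)"
  proof (rule bdd_belowI2)
    fix y assume "y \<in> U"
    then show "min m n \<le> ?w y" using m[of y] n[of y] by (auto simp: min_def)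
  qed
  have uc: "continuous_on U u" by (rule superharmonic_continuous_on[OF U u])
  have "continuous_on (ball x0 s) (\<lambda>y. min (u y) (v y))"
    by (intro continuous_intros continuous_on_subset[OF uc sub] superharmonic_continuous_on v)
      auto
  then have "continuous_on (ball x0 s) ?w" by (rule continuous_on_eq) auto
  moreover have "continuous_on (U - cball x0 (s / 2)) u"
    by (rule continuous_on_subset[OF uc]) auto
  then have "continuous_on (U - cball x0 (s / 2)) ?w"
    by (rule continuous_on_eq) (use outside in auto)
  ultimately have "continuous_on (ball x0 s \<union> (U - cball x0 (s / 2))) ?w"
    using U by (intro continuous_on_open_Un) auto
  moreover have "U = ball x0 s \<union> (U - cball x0 (s / 2))" using sub s by auto
  ultimately show "continuous_on U ?w" by simp
  fix x assume x: "x \<in> U"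
  have near: "cball y \<rho> \<subseteq> ball x (2 * r)" if "y \<in> ball x r" "\<rho> < r" for y r \<rho>
  proof
    fix z assume "z \<in> cball y \<rho>"
    then show "z \<in> ball x (2 * r)" using that dist_triangle[of x z y] by auto
  qed
  show "\<exists>r>0. \<forall>y\<in>ball x r. \<forall>\<rho>. 0 < \<rho> \<longrightarrow> \<rho> < r \<longrightarrow> cone_ball ?w y \<rho>"
  proof (cases "x \<in> ball x0 s")
    case True
    then obtain r where r: "r > 0" "ball x r \<subseteq> ball x0 s" using open_ball openE by metis
    have "cone_ball ?w y \<rho>" if "y \<in> ball x (r / 2)" "\<rho> < r / 2" for y \<rho>
    proof -
      have cb: "cball y \<rho> \<subseteq> ball x0 s" using near[OF that] r by simp
      show ?thesis
        by (rule cone_ball_min[OF superharmonic_cone_ball[OF u] superharmonic_cone_ball[OF v cb]])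
          (use cb sub in auto)
    qed
    then show ?thesis using r by (intro exI[of _ "r / 2"]) auto
  next
    case False
    obtain r' where r': "r' > 0" "ball x r' \<subseteq> U" using U x openE by blast
    define r where "r = min (r' / 2) (s / 4)"
    have r: "0 < r" "2 * r \<le> r'" "2 * r \<le> s / 2" using r' s by (auto simp: r_def)
    have "cone_ball ?w y \<rho>" if "y \<in> ball x r" "\<rho> < r" for y \<rho>
    proof (rule cone_ball_cong)
      have cb: "cball y \<rho> \<subseteq> ball x (2 * r)" using near[OF that] .
      then have "cball y \<rho> \<subseteq> U" using r' r subset_ball[OF r(2), of x] by blast
      then show "cone_ball u y \<rho>" by (rule superharmonic_cone_ball[OF u])
      fix z assume "z \<in> cball y \<rho>"
      then have "dist x z < 2 * r" using cb by auto
      then have "s / 2 \<le> dist x0 z"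
        using False r dist_triangle[of x0 x z] by (auto simp: dist_commute)
      then show "?w z = u z" by (rule outside)
    qed
    then show ?thesis using r by blast
  qed
qed

end

section \<open>The distance to the boundary\<close>

locale bounded_domain = proper_geodesic_space "TYPE('a)" for \<Omega> :: "'a::metric_space set" +
  assumes open_domain: "open \<Omega>" and connected_domain: "connected \<Omega>"
    and nonempty: "\<Omega> \<noteq> {}" and bounded_domain: "bounded \<Omega>" and not_UNIV: "\<Omega> \<noteq> UNIV"
begin

abbreviation D :: "'a \<Rightarrow> real" where "D x \<equiv> infdist x (frontier \<Omega>)"
abbreviation R :: real where "R \<equiv> R_infty \<Omega>"
abbreviation \<Lambda> :: real where "\<Lambda> \<equiv> Lambda_infty \<Omega>"

lemma compact_closure_domain: "compact (closure \<Omega>)"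
  using bounded_domain by (intro compact_of_closed_bounded) auto

lemma compact_frontier_domain: "compact (frontier \<Omega>)"
  by (rule compact_of_closed_bounded[OF _ bounded_subset[of "closure \<Omega>"]])
    (use bounded_domain in \<open>auto simp: frontier_def\<close>)

lemma frontier_nonempty: "frontier \<Omega> \<noteq> {}"
proof -
  obtain x y where "x \<in> \<Omega>" "y \<notin> \<Omega>" using nonempty not_UNIV by blast
  then show ?thesis using exit_point[of x \<Omega> y] by blast
qed

lemma frontier_not_in: "x \<in> \<Omega> \<Longrightarrow> x \<notin> frontier \<Omega>"
  using open_domain by (simp add: frontier_def interior_open)

lemma in_domain_or_frontier: "x \<in> closure \<Omega> \<Longrightarrow> x \<in> \<Omega> \<or> x \<in> frontier \<Omega>"
  using open_domain by (simp add: frontier_def interior_open)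

lemma nearest_frontier_point:
  obtains z where "z \<in> frontier \<Omega>" "D x = dist x z"
proof -
  have "continuous_on (frontier \<Omega>) (dist x)" by (intro continuous_intros)
  then obtain z where z: "z \<in> frontier \<Omega>" "\<And>y. y \<in> frontier \<Omega> \<Longrightarrow> dist x z \<le> dist x y"
    using continuous_attains_inf[OF compact_frontier_domain frontier_nonempty] by metis
  have "dist x z \<le> D x"
    unfolding infdist_notempty[OF frontier_nonempty]
    by (rule cINF_greatest[OF frontier_nonempty z(2)])
  then have "D x = dist x z" using infdist_le[OF z(1), of x] by simp
  then show thesis using that z by blast
qed

lemma ball_D_subset: "x \<in> \<Omega> \<Longrightarrow> ball x (D x) \<subseteq> \<Omega>"
proof
  fix y assume x: "x \<in> \<Omega>" and y: "y \<in> ball x (D x)"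
  show "y \<in> \<Omega>"
  proof (rule ccontr)
    assume "y \<notin> \<Omega>"
    then obtain z where z: "z \<in> frontier \<Omega>" "dist x z + dist z y = dist x y"
      using exit_point[OF x] by blast
    then show False using infdist_le[OF z(1), of x] y zero_le_dist[of z y] by simp
  qed
qed

lemma cball_subset: "x \<in> \<Omega> \<Longrightarrow> r < D x \<Longrightarrow> cball x r \<subseteq> \<Omega>"
  using ball_D_subset[of x] by (auto simp: subset_iff)

lemma D_pos: "x \<in> \<Omega> \<Longrightarrow> 0 < D x"
  using infdist_pos_not_in_closed[OF frontier_closed frontier_nonempty] frontier_not_in by blast

lemma D_le_R: "x \<in> closure \<Omega> \<Longrightarrow> D x \<le> R"
  unfolding R_infty_def
  by (rule cSUP_upper) (auto intro!: bounded_imp_bdd_above compact_imp_bounded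
      compact_continuous_image continuous_intros compact_closure_domain)

lemma R_pos: "0 < R"
proof -
  obtain x where "x \<in> \<Omega>" using nonempty by blast
  then show ?thesis using D_pos D_le_R closure_subset by (meson less_le_trans subsetD)
qed

lemma \<Lambda>_pos: "0 < \<Lambda>"
  using R_pos by (simp add: Lambda_infty_def)

lemma \<Lambda>_D_le_1: "x \<in> closure \<Omega> \<Longrightarrow> \<Lambda> * D x \<le> 1"
  using D_le_R[of x] R_pos by (simp add: Lambda_infty_def)

lemma max_dist_set_nonempty: "max_dist_set \<Omega> \<noteq> {}"
proof -
  have "continuous_on (closure \<Omega>) D" by (intro continuous_intros)
  then obtain x where x: "x \<in> closure \<Omega>" "\<And>y. y \<in> closure \<Omega> \<Longrightarrow> D y \<le> D x"
    using continuous_attains_sup[OF compact_closure_domain] nonempty by (metis closure_eq_empty)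
  have "R \<le> D x"
    unfolding R_infty_def by (rule cSUP_least) (use x nonempty in auto)
  then have DR: "D x = R" using D_le_R[OF x(1)] by simp
  then have "x \<notin> frontier \<Omega>" using R_pos by auto
  then show ?thesis using in_domain_or_frontier[OF x(1)] DR by (auto simp: max_dist_set_def)
qed

text \<open>A cone that is at most as steep as \<open>\<Lambda> D\<close> is compared along the geodesic to a nearest boundary point,
  on which \<open>D\<close> decreases at unit speed. A steeper cone is compared along the geodesic towards its vertex,
  on which it rises faster than \<open>\<Lambda> D\<close> can.\<close>

lemma D_superharmonic: "infty_superharmonic_on \<Omega> (\<lambda>x. \<Lambda> * D x)"
  unfolding infty_superharmonic_on_def
proof (intro conjI ballI allI impI)
  show "bdd_below ((\<lambda>x. \<Lambda> * D x) ` \<Omega>)"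
    by (rule bdd_belowI2[of _ 0]) (simp add: \<Lambda>_pos less_imp_le infdist_nonneg)
  fix xh a \<kappa> V x
  assume \<kappa>: "\<kappa> \<le> (0::real)"
    and V: "open V \<and> bounded V \<and> closure V \<subseteq> \<Omega> \<and> xh \<notin> V"
    and bd: "\<forall>y\<in>frontier V. a + \<kappa> * dist xh y \<le> \<Lambda> * D y" and x: "x \<in> closure V"
  show "a + \<kappa> * dist xh x \<le> \<Lambda> * D x"
  proof (cases "x \<in> frontier V")
    case True
    then show ?thesis using bd by blast
  next
    case False
    then have xV: "x \<in> V" using x V by (simp add: frontier_def interior_open)
    show ?thesis
    proof (cases "- \<kappa> \<le> \<Lambda>")
      case True
      obtain z where z: "z \<in> frontier \<Omega>" "D x = dist x z" using nearest_frontier_point .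
      have "z \<notin> V" using z V frontier_not_in closure_subset by blast
      then obtain y where y: "y \<in> frontier V" "dist x y + dist y z = dist x z"
        using exit_point[OF xV] by blast
      have "D y \<le> D x - dist x y" using infdist_le[OF z(1), of y] y z by simp
      then have "\<Lambda> * D y \<le> \<Lambda> * D x - \<Lambda> * dist x y"
        using \<Lambda>_pos mult_left_mono[of "D y" "D x - dist x y" \<Lambda>] by (simp add: algebra_simps)
      moreover have "a + \<kappa> * dist xh y \<le> \<Lambda> * D y" using bd y by blast
      moreover have "\<kappa> * (dist xh x + dist x y) \<le> \<kappa> * dist xh y"
        using \<kappa> dist_triangle[of xh y x] by (intro mult_left_mono_neg)
      moreover have "- \<kappa> * dist x y \<le> \<Lambda> * dist x y" using True by (rule mult_right_mono) simp
      ultimately show ?thesis by (simp add: algebra_simps)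
    next
      case False
      obtain y where y: "y \<in> frontier V" "dist x y + dist y xh = dist x xh"
        using exit_point[OF xV] V by blast
      have "\<Lambda> * D y \<le> \<Lambda> * (D x + dist x y)"
        using \<Lambda>_pos infdist_triangle[of y "frontier \<Omega>" x]
        by (intro mult_left_mono) (auto simp: dist_commute)
      moreover have "a + \<kappa> * dist xh y \<le> \<Lambda> * D y" using bd y by blast
      moreover have "\<kappa> * dist xh y = \<kappa> * dist xh x - \<kappa> * dist x y"
        using y by (simp add: dist_commute flip: right_diff_distrib)
      moreover have "\<Lambda> * dist x y \<le> - \<kappa> * dist x y" using False by (intro mult_right_mono) auto
      ultimately show ?thesis by (simp add: algebra_simps)
    qed
  qed
qed

text \<open>Along a geodesic to a nearest boundary point the function falls at rate \<open>\<Lambda>\<close>, and \<open>\<Lambda> D \<le> 1\<close>.\<close>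

lemma D_competitor: "(\<lambda>x. \<Lambda> * D x) \<in> competitors \<Omega>"
proof -
  have slope: "ereal (\<Lambda> * (\<Lambda> * D x)) \<le> subslope (\<lambda>x. \<Lambda> * D x) x" if x: "x \<in> \<Omega>" for x
  proof -
    have "ereal \<Lambda> \<le> subslope (\<lambda>x. \<Lambda> * D x) x"
    proof (rule subslope_ge[OF D_pos[OF x]])
      fix \<rho> assume \<rho>: "0 < \<rho>" "\<rho> < D x"
      obtain z where z: "z \<in> frontier \<Omega>" "D x = dist x z" using nearest_frontier_point .
      obtain p where p: "dist x p = \<rho>" "dist p z = dist x z - \<rho>"
        using point_between[of \<rho> x z] \<rho> z by auto
      have "D p \<le> D x - \<rho>" using infdist_le[OF z(1), of p] p z by simp
      then have "\<Lambda> * D p \<le> \<Lambda> * (D x - \<rho>)" using \<Lambda>_pos by (intro mult_left_mono) auto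
      then show "\<exists>z\<in>sphere x \<rho>. \<Lambda> * D z \<le> \<Lambda> * D x - \<Lambda> * \<rho>"
        using p by (intro bexI[of _ p]) (auto simp: algebra_simps)
    qed
    moreover have "\<Lambda> * (\<Lambda> * D x) \<le> \<Lambda> * 1"
      using \<Lambda>_D_le_1[of x] x closure_subset \<Lambda>_pos by (intro mult_left_mono) auto
    ultimately show ?thesis by (metis ereal_less_eq(3) mult.right_neutral order_trans)
  qed
  have norm: "normalized_on \<Omega> (\<lambda>x. \<Lambda> * D x)"
    unfolding normalized_on_def max_dist_set_def
    using \<Lambda>_D_le_1 R_pos by (auto simp: Lambda_infty_def)
  show ?thesis
    unfolding competitors_def supersolution_def
    using superharmonic_locally_lipschitz[OF open_domain D_superharmonic] D_superharmonic slope norm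
      D_pos \<Lambda>_pos infdist_nonneg by auto
qed

section \<open>The Perron infimum\<close>

lemma competitor_bounds:
  assumes "u \<in> competitors \<Omega>" "x \<in> closure \<Omega>"
  shows "0 \<le> u x" "u x \<le> 1"
proof -
  show "0 \<le> u x"
    using assms in_domain_or_frontier[OF assms(2)] unfolding competitors_def by force
  show "u x \<le> 1"
    using assms max_dist_set_nonempty unfolding competitors_def normalized_on_def by force
qed

lemma u_infty_le: "u \<in> competitors \<Omega> \<Longrightarrow> x \<in> closure \<Omega> \<Longrightarrow> u_infty \<Omega> x \<le> u x"
  unfolding u_infty_def using competitor_bounds(1)
  by (intro cINF_lower) (auto intro!: bdd_belowI2[of _ 0])

lemma u_infty_ge: "(\<And>u. u \<in> competitors \<Omega> \<Longrightarrow> c \<le> u x) \<Longrightarrow> c \<le> u_infty \<Omega> x"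
  unfolding u_infty_def using D_competitor by (intro cINF_greatest) auto

lemma u_infty_nonneg: "x \<in> closure \<Omega> \<Longrightarrow> 0 \<le> u_infty \<Omega> x"
  using competitor_bounds(1) by (intro u_infty_ge) auto

lemma u_infty_le_1: "x \<in> closure \<Omega> \<Longrightarrow> u_infty \<Omega> x \<le> 1"
  using u_infty_le[OF D_competitor] \<Lambda>_D_le_1 order_trans by blast

lemma u_infty_eq_1:
  assumes "x \<in> max_dist_set \<Omega>"
  shows "u_infty \<Omega> x = 1"
proof (rule antisym)
  have "x \<in> closure \<Omega>" using assms closure_subset by (auto simp: max_dist_set_def)
  then show "u_infty \<Omega> x \<le> 1" by (rule u_infty_le_1)
  show "1 \<le> u_infty \<Omega> x"
    using assms by (intro u_infty_ge) (auto simp: competitors_def normalized_on_def)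
qed

lemma u_infty_normalized: "normalized_on \<Omega> (u_infty \<Omega>)"
  using u_infty_eq_1 u_infty_le_1 by (simp add: normalized_on_def)

lemma u_infty_frontier:
  assumes "x \<in> frontier \<Omega>"
  shows "u_infty \<Omega> x = 0"
proof -
  have "x \<in> closure \<Omega>" using assms by (simp add: frontier_def)
  then show ?thesis using u_infty_le[OF D_competitor] u_infty_nonneg assms by fastforce
qed

lemma u_infty_superharmonic: "infty_superharmonic_on \<Omega> (u_infty \<Omega>)"
  unfolding infty_superharmonic_on_def
proof (intro conjI ballI allI impI)
  show "bdd_below (u_infty \<Omega> ` \<Omega>)"
    using u_infty_nonneg closure_subset by (intro bdd_belowI2[of _ 0]) blast
  fix xh a \<kappa> V x
  assume xh: "xh \<in> \<Omega>" and \<kappa>: "\<kappa> \<le> (0::real)"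
    and V: "open V \<and> bounded V \<and> closure V \<subseteq> \<Omega> \<and> xh \<notin> V"
    and bd: "\<forall>y\<in>frontier V. a + \<kappa> * dist xh y \<le> u_infty \<Omega> y" and x: "x \<in> closure V"
  show "a + \<kappa> * dist xh x \<le> u_infty \<Omega> x"
  proof (rule u_infty_ge)
    fix u assume u: "u \<in> competitors \<Omega>"
    have sh: "infty_superharmonic_on \<Omega> u"
      using u by (simp add: competitors_def supersolution_def)
    show "a + \<kappa> * dist xh x \<le> u x"
    proof (rule superharmonicD[OF sh xh \<kappa> _ _ _ _ _ x])
      fix y assume y: "y \<in> frontier V"
      have "frontier V \<subseteq> closure V" by (simp add: frontier_def)
      then have "y \<in> closure \<Omega>" using y V closure_subset by blast
      then show "a + \<kappa> * dist xh y \<le> u y" using u_infty_le[OF u] bd y by fastforce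
    qed (use V in auto)
  qed
qed

lemma u_infty_continuous_on_domain: "continuous_on \<Omega> (u_infty \<Omega>)"
  by (rule superharmonic_continuous_on[OF open_domain u_infty_superharmonic])

text \<open>The drop estimate with lower bound \<open>0\<close>, in the limit where the radius tends to the distance to the
  boundary.\<close>

lemma u_infty_cone_bound:
  assumes x: "x \<in> \<Omega>" and y: "dist x y < D x"
  shows "u_infty \<Omega> x * (1 - dist x y / D x) \<le> u_infty \<Omega> y"
proof -
  have "((\<lambda>\<rho>. u_infty \<Omega> x * (1 - dist x y / \<rho>)) \<longlongrightarrow> u_infty \<Omega> x * (1 - dist x y / D x))
    (at_left (D x))"
    using D_pos[OF x] by (intro tendsto_intros) auto
  then show ?thesis
  proof (rule tendsto_upperbound)
    have "u_infty \<Omega> x * (1 - dist x y / \<rho>) \<le> u_infty \<Omega> y" if "dist x y < \<rho>" "\<rho> < D x" for \<rho>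
    proof -
      have "u_infty \<Omega> x - (u_infty \<Omega> x - 0) / \<rho> * dist x y \<le> u_infty \<Omega> y"
        by (rule superharmonic_drop[OF u_infty_superharmonic cball_subset[OF x that(2)]])
          (use u_infty_nonneg closure_subset that in auto)
      then show ?thesis by (simp add: algebra_simps)
    qed
    then show "\<forall>\<^sub>F \<rho> in at_left (D x). u_infty \<Omega> x * (1 - dist x y / \<rho>) \<le> u_infty \<Omega> y"
      unfolding eventually_at_left_field using y by blast
  qed simp
qed

text \<open>The bound above makes positivity spread from \<open>y\<close> to the ball of radius \<open>D y\<close>. Since \<open>D\<close> is
  continuous and positive, a zero has a neighbourhood all of whose points reach it in this way, so the
  zero set is open.\<close>

lemma u_infty_pos:
  assumes "x \<in> \<Omega>"
  shows "0 < u_infty \<Omega> x"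
proof -
  define P where "P = {x \<in> \<Omega>. 0 < u_infty \<Omega> x}"
  have spread: "0 < u_infty \<Omega> z" if "y \<in> \<Omega>" "dist y z < D y" "0 < u_infty \<Omega> y" for y z
  proof -
    have "0 < u_infty \<Omega> y * (1 - dist y z / D y)" using that D_pos by simp
    then show ?thesis using u_infty_cone_bound[OF that(1,2)] by linarith
  qed
  have "openin (top_of_set \<Omega>) P"
    unfolding P_def using continuous_openin_preimage_gen[OF u_infty_continuous_on_domain, of "{0<..}"]
    by (simp add: vimage_def Int_def)
  moreover have "openin (top_of_set \<Omega>) (\<Omega> - P)"
  proof -
    have "\<exists>T. open T \<and> y \<in> T \<and> T \<subseteq> \<Omega> - P" if y: "y \<in> \<Omega> - P" for y
    proof (intro exI conjI)
      show "y \<in> ball y (D y / 2)" using y D_pos by simp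
      show "ball y (D y / 2) \<subseteq> \<Omega> - P"
      proof
        fix z assume z: "z \<in> ball y (D y / 2)"
        have "D y \<le> D z + dist y z" by (rule infdist_triangle)
        then have "dist z y < D z" using z by (auto simp: dist_commute)
        then show "z \<in> \<Omega> - P"
          using spread[of z y] y z ball_D_subset[of y] D_pos[of y] by (auto simp: P_def subset_iff)
      qed
    qed auto
    then have "open (\<Omega> - P)" by (subst open_subopen) blast
    then show ?thesis using open_domain by (simp add: openin_open_eq)
  qed
  then have "closedin (top_of_set \<Omega>) P"
    by (simp add: closedin_def P_def)
  moreover have "P \<noteq> {}"
    using max_dist_set_nonempty u_infty_eq_1 by (force simp: P_def max_dist_set_def)
  ultimately have "P = \<Omega>" using connected_domain unfolding connected_clopen by blast
  then show ?thesis using assms by (auto simp: P_def)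
qed

lemma u_infty_continuous: "continuous_on (closure \<Omega>) (u_infty \<Omega>)"
  unfolding continuous_on_def
proof
  fix x assume x: "x \<in> closure \<Omega>"
  show "(u_infty \<Omega> \<longlongrightarrow> u_infty \<Omega> x) (at x within closure \<Omega>)"
  proof (cases "x \<in> \<Omega>")
    case True
    then have "isCont (u_infty \<Omega>) x"
      using u_infty_continuous_on_domain open_domain continuous_on_eq_continuous_at by blast
    then show ?thesis using continuous_at_imp_continuous_at_within continuous_within by blast
  next
    case False
    then have fr: "x \<in> frontier \<Omega>" using in_domain_or_frontier x by blast
    have "((\<lambda>y. \<Lambda> * D y) \<longlongrightarrow> \<Lambda> * D x) (at x within closure \<Omega>)" by (intro tendsto_intros)
    then have lim: "((\<lambda>y. \<Lambda> * D y) \<longlongrightarrow> 0) (at x within closure \<Omega>)" using fr by simp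
    have "(u_infty \<Omega> \<longlongrightarrow> 0) (at x within closure \<Omega>)"
      by (rule tendsto_sandwich[OF _ _ tendsto_const lim])
        (auto simp: eventually_at_filter u_infty_nonneg u_infty_le[OF D_competitor])
    then show ?thesis using u_infty_frontier[OF fr] by simp
  qed
qed

text \<open>At scale \<open>\<rho>\<close> the slope condition for a competitor reads: the minimum over the sphere is at most
  \<open>(1 - \<Lambda> \<rho>) u x\<close>. As \<open>\<Lambda> \<rho> < 1\<close>, the factor is positive and the inequality passes to the infimum.\<close>

lemma u_infty_supersolution: "supersolution \<Lambda> \<Omega> (u_infty \<Omega>)"
  unfolding supersolution_def
proof (intro conjI ballI)
  show "locally_lipschitz_on \<Omega> (u_infty \<Omega>)"
    by (rule superharmonic_locally_lipschitz[OF open_domain u_infty_superharmonic])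
  show "infty_superharmonic_on \<Omega> (u_infty \<Omega>)" by (rule u_infty_superharmonic)
  fix x assume x: "x \<in> \<Omega>"
  have xcl: "x \<in> closure \<Omega>" using x closure_subset by blast
  show "ereal (\<Lambda> * u_infty \<Omega> x) \<le> subslope (u_infty \<Omega>) x"
  proof (rule subslope_ge[OF D_pos[OF x]])
    fix \<rho> assume \<rho>: "0 < \<rho>" "\<rho> < D x"
    have cb: "cball x \<rho> \<subseteq> \<Omega>" by (rule cball_subset[OF x \<rho>(2)])
    have "\<Lambda> * \<rho> < \<Lambda> * D x" using \<rho> \<Lambda>_pos by simp
    then have pos: "0 < 1 - \<Lambda> * \<rho>" using \<Lambda>_D_le_1[OF xcl] by linarith
    have desc: "\<exists>z\<in>sphere x \<rho>. u z \<le> u x * (1 - \<Lambda> * \<rho>)" if u: "u \<in> competitors \<Omega>" for u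
    proof -
      have "\<exists>z\<in>sphere x \<rho>. u z \<le> u x - (\<Lambda> * u x) * \<rho>"
        by (rule superharmonic_steepest_descent[OF open_domain _ cb \<rho>(1)])
          (use u x \<Lambda>_pos in \<open>auto simp: competitors_def supersolution_def\<close>)
      then show ?thesis by (simp add: algebra_simps)
    qed
    then have ne: "sphere x \<rho> \<noteq> {}" using D_competitor by blast
    have "continuous_on (sphere x \<rho>) (u_infty \<Omega>)"
      by (rule continuous_on_subset[OF u_infty_continuous_on_domain]) (use cb in auto)
    then obtain z where z: "z \<in> sphere x \<rho>" "\<And>y. y \<in> sphere x \<rho> \<Longrightarrow> u_infty \<Omega> z \<le> u_infty \<Omega> y"
      using continuous_attains_inf[OF compact_sphere ne] by metis
    have "u_infty \<Omega> z / (1 - \<Lambda> * \<rho>) \<le> u_infty \<Omega> x"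
    proof (rule u_infty_ge)
      fix u assume u: "u \<in> competitors \<Omega>"
      then obtain y where y: "y \<in> sphere x \<rho>" "u y \<le> u x * (1 - \<Lambda> * \<rho>)" using desc by blast
      have "y \<in> \<Omega>" using y cb by auto
      then have "u_infty \<Omega> y \<le> u y" using u_infty_le[OF u] closure_subset by blast
      then have "u_infty \<Omega> z \<le> u x * (1 - \<Lambda> * \<rho>)" using z(2)[OF y(1)] y(2) by linarith
      then show "u_infty \<Omega> z / (1 - \<Lambda> * \<rho>) \<le> u x" using pos by (simp add: divide_le_eq)
    qed
    then have "u_infty \<Omega> z \<le> u_infty \<Omega> x * (1 - \<Lambda> * \<rho>)" using pos by (simp add: divide_le_eq)
    then show "\<exists>z\<in>sphere x \<rho>. u_infty \<Omega> z \<le> u_infty \<Omega> x - \<Lambda> * u_infty \<Omega> x * \<rho>"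
      using z(1) by (intro bexI[of _ z]) (auto simp: algebra_simps)
  qed
qed

section \<open>The subsolution property\<close>

text \<open>Taking a minimum can only increase the subslope where the minimum is attained, so the slope condition
  for the glued function is inherited from whichever function is active. Keeping the ball off
  \<open>\<M>(\<Omega>)\<close> preserves the normalization.\<close>

lemma glued_competitor:
  assumes v: "infty_superharmonic_on (ball x0 s) v" and sub: "ball x0 s \<subseteq> \<Omega>" and s: "0 < s"
    and le: "\<And>y. y \<in> ball x0 s \<Longrightarrow> s / 2 \<le> dist x0 y \<Longrightarrow> u_infty \<Omega> y < v y"
    and pos: "\<And>y. y \<in> ball x0 s \<Longrightarrow> 0 < v y"
    and off: "\<And>y. y \<in> ball x0 s \<Longrightarrow> y \<notin> max_dist_set \<Omega>"
    and slope: "\<And>y. y \<in> ball x0 s \<Longrightarrow> ereal (\<Lambda> * u_infty \<Omega> y) \<le> subslope v y"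
  shows "(\<lambda>y. if y \<in> ball x0 s then min (u_infty \<Omega> y) (v y) else u_infty \<Omega> y) \<in> competitors \<Omega>"
    (is "?w \<in> _")
proof -
  have w_le: "?w y \<le> u_infty \<Omega> y" for y by simp
  have sh: "infty_superharmonic_on \<Omega> ?w"
    by (rule superharmonic_glue[OF open_domain u_infty_superharmonic v sub s])
      (use le in \<open>auto intro: less_imp_le\<close>)
  have wslope: "ereal (\<Lambda> * ?w x) \<le> subslope ?w x" if x: "x \<in> \<Omega>" for x
  proof (cases "x \<in> ball x0 s \<and> v x \<le> u_infty \<Omega> x")
    case True
    then have xb: "x \<in> ball x0 s" and wx: "?w x = v x" by auto
    have "\<forall>\<^sub>F y in at x. y \<in> ball x0 s"
      by (rule eventually_at_in_open') (use xb in auto)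
    then have "subslope v x \<le> subslope ?w x"
      by (intro subslope_mono) (use wx in \<open>auto elim!: eventually_mono\<close>)
    moreover have "\<Lambda> * ?w x \<le> \<Lambda> * u_infty \<Omega> x" using w_le \<Lambda>_pos by (intro mult_left_mono) auto
    ultimately show ?thesis using slope[OF xb] by (meson ereal_less_eq(3) order_trans)
  next
    case False
    then have wx: "?w x = u_infty \<Omega> x" by auto
    have "ereal (\<Lambda> * u_infty \<Omega> x) \<le> subslope (u_infty \<Omega>) x"
      using u_infty_supersolution x by (simp add: supersolution_def)
    also have "\<dots> \<le> subslope ?w x" by (intro subslope_mono always_eventually allI w_le wx)
    finally show ?thesis by (simp only: wx)
  qed
  have nm: "normalized_on \<Omega> ?w"
    unfolding normalized_on_def
  proof (intro ballI conjI)
    fix x assume x: "x \<in> max_dist_set \<Omega>"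
    then have w1: "?w x = 1" using off u_infty_eq_1 by auto
    then show "?w x = 1" .
    fix y assume "y \<in> closure \<Omega>"
    then show "?w y \<le> ?w x" using w1 w_le[of y] u_infty_le_1[of y] by linarith
  qed
  have "\<forall>x\<in>\<Omega>. 0 < ?w x" using u_infty_pos pos by auto
  moreover have "\<forall>x\<in>frontier \<Omega>. 0 \<le> ?w x"
    using u_infty_frontier sub frontier_not_in by (auto simp: subset_iff)
  ultimately show ?thesis
    unfolding competitors_def supersolution_def
    using sh superharmonic_locally_lipschitz[OF open_domain sh] wslope nm by blast
qed

text \<open>At a point of \<open>\<M>(\<Omega>)\<close> the function \<open>v\<close> is squeezed above the cone of slope \<open>1 / R = \<Lambda>\<close> that lies
  below \<open>u\<^sub>\<infinity>\<close>.\<close>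

lemma touching_at_max_dist:
  assumes x0: "x0 \<in> max_dist_set \<Omega>"
    and touch: "\<forall>\<^sub>F y in at x0. u_infty \<Omega> y - v y < u_infty \<Omega> x0 - v x0"
  shows "subslope v x0 \<le> ereal \<Lambda>"
proof -
  have x: "x0 \<in> \<Omega>" and DR: "D x0 = R" using x0 by (auto simp: max_dist_set_def)
  obtain d where d: "d > 0"
    "\<And>y. y \<noteq> x0 \<Longrightarrow> dist y x0 < d \<Longrightarrow> u_infty \<Omega> y - v y < u_infty \<Omega> x0 - v x0"
    using touch unfolding eventually_at by auto
  show ?thesis
  proof (rule subslope_le[of "min d R"])
    fix z assume z: "z \<in> ball x0 (min d R)"
    have "1 - dist x0 z / R \<le> u_infty \<Omega> z"
      using u_infty_cone_bound[OF x, of z] z u_infty_eq_1[OF x0] DR by auto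
    moreover have "u_infty \<Omega> z - v z \<le> u_infty \<Omega> x0 - v x0"
      using d(2)[of z] z by (cases "z = x0") (auto simp: dist_commute)
    ultimately show "v x0 - \<Lambda> * dist x0 z \<le> v z"
      using u_infty_eq_1[OF x0] by (simp add: Lambda_infty_def)
  qed (use d R_pos \<Lambda>_pos in auto)
qed

text \<open>If the infimum were too large, a translate \<open>v + t\<close> would lie above \<open>u\<^sub>\<infinity>\<close> on an annulus around \<open>x0\<close>
  but below it at \<open>x0\<close>, and gluing would produce a competitor smaller than the infimum.\<close>

lemma touching_off_max_dist:
  assumes x0: "x0 \<in> \<Omega>" "x0 \<notin> max_dist_set \<Omega>" and r0: "0 < r0" "ball x0 r0 \<subseteq> \<Omega>"
    and v: "infty_superharmonic_on (ball x0 r0) v"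
    and touch: "\<forall>\<^sub>F y in at x0. u_infty \<Omega> y - v y < u_infty \<Omega> x0 - v x0"
    and r: "0 < r"
  shows "(INF x\<in>ball x0 r. subslope v x) \<le> ereal (\<Lambda> * u_infty \<Omega> x0)"
proof (rule ccontr)
  let ?u = "u_infty \<Omega>"
  assume "\<not> ?thesis"
  then obtain c where c: "ereal (\<Lambda> * ?u x0) < ereal c" "ereal c < (INF x\<in>ball x0 r. subslope v x)"
    by (auto dest: ereal_dense2 simp: not_le)
  have slope: "ereal c \<le> subslope v y" if "y \<in> ball x0 r" for y
    using c(2) INF_lower[OF that, of "subslope v"] by (simp add: less_imp_le less_le_trans)
  have ux0: "0 < ?u x0" by (rule u_infty_pos[OF x0(1)])
  have ucont: "isCont ?u x0"
    using u_infty_continuous_on_domain open_domain x0 continuous_on_eq_continuous_at by blast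
  have vcont: "continuous_on (ball x0 r0) v" by (rule superharmonic_continuous_on[OF open_ball v])
  then have vx0: "isCont v x0" using r0 continuous_on_eq_continuous_at[OF open_ball] by (metis centre_in_ball)
  have e1: "\<forall>\<^sub>F y in nhds x0. y \<in> ball x0 r0 \<and> y \<in> ball x0 r"
    by (intro eventually_conj eventually_nhds_in_open) (use r r0 in auto)
  have e2: "\<forall>\<^sub>F y in nhds x0. y \<noteq> x0 \<longrightarrow> ?u y - v y < ?u x0 - v x0"
    using touch by (simp add: eventually_at_filter)
  have "(?u \<longlongrightarrow> ?u x0) (nhds x0)"
    using ucont unfolding isCont_def tendsto_at_iff_tendsto_nhds .
  then have "((\<lambda>y. \<Lambda> * ?u y) \<longlongrightarrow> \<Lambda> * ?u x0) (nhds x0)" by (intro tendsto_intros)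
  then have e3: "\<forall>\<^sub>F y in nhds x0. \<Lambda> * ?u y < c"
    by (rule order_tendstoD) (use c in simp)
  have "(v \<longlongrightarrow> v x0) (nhds x0)" using vx0 unfolding isCont_def tendsto_at_iff_tendsto_nhds .
  then have e4: "\<forall>\<^sub>F y in nhds x0. v x0 - ?u x0 / 2 < v y"
    by (rule order_tendstoD) (use ux0 in simp)
  have "D x0 < R"
    using x0 D_le_R[of x0] closure_subset by (force simp: max_dist_set_def)
  moreover have "(D \<longlongrightarrow> D x0) (nhds x0)" by (intro tendsto_intros filterlim_ident)
  ultimately have e5: "\<forall>\<^sub>F y in nhds x0. D y < R" by (rule order_tendstoD(2)[rotated])
  obtain d where d: "0 < d" and near: "\<And>y. dist y x0 < d \<Longrightarrow>
      (y \<in> ball x0 r0 \<and> y \<in> ball x0 r) \<and> (y \<noteq> x0 \<longrightarrow> ?u y - v y < ?u x0 - v x0) \<and>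
      \<Lambda> * ?u y < c \<and> v x0 - ?u x0 / 2 < v y \<and> D y < R"
    using eventually_conj[OF e1 eventually_conj[OF e2 eventually_conj[OF e3 eventually_conj[OF e4 e5]]]]
    unfolding eventually_nhds_metric by blast
  define s where "s = d / 2"
  have s: "0 < s" "s < d" using d by (auto simp: s_def)
  have nr: "dist y x0 < d" if "y \<in> cball x0 s" for y using that s by (auto simp: dist_commute)
  \<comment> \<open>On the compact annulus the strict maximum leaves a uniform gap, half of which can be given up.\<close>
  define A where "A = cball x0 s - ball x0 (s / 2)"
  have "compact A" unfolding A_def by (intro compact_diff proper) auto
  have "continuous_on A (\<lambda>y. ?u y - v y)"
  proof (intro continuous_intros)
    have "A \<subseteq> ball x0 r0" using near nr by (auto simp: A_def)
    then show "continuous_on A v" "continuous_on A ?u"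
      using continuous_on_subset vcont u_infty_continuous_on_domain r0 by blast+
  qed
  have "\<exists>e>0. e \<le> ?u x0 / 2 \<and> (\<forall>y\<in>A. ?u y - v y + e < ?u x0 - v x0)"
  proof (cases "A = {}")
    case True
    then show ?thesis using ux0 by (intro exI[of _ "?u x0 / 2"]) auto
  next
    case False
    then obtain z where z: "z \<in> A" "\<And>y. y \<in> A \<Longrightarrow> ?u y - v y \<le> ?u z - v z"
      using continuous_attains_sup[OF \<open>compact A\<close> False \<open>continuous_on A _\<close>] by blast
    have "z \<noteq> x0" "dist z x0 < d" using z(1) s nr by (auto simp: A_def)
    then have gap: "?u z - v z < ?u x0 - v x0" using near by blast
    define e where "e = min (?u x0 / 2) ((?u x0 - v x0 - (?u z - v z)) / 2)"
    have "0 < e" "e \<le> ?u x0 / 2" "?u z - v z + e < ?u x0 - v x0"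
      using gap ux0 by (auto simp: e_def min_def field_simps)
    then show ?thesis using z(2) by (intro exI[of _ e]) force
  qed
  then obtain e where e: "0 < e" "e \<le> ?u x0 / 2" "\<And>y. y \<in> A \<Longrightarrow> ?u y - v y + e < ?u x0 - v x0"
    by blast
  \<comment> \<open>The translate passes \<open>e\<close> below \<open>u\<^sub>\<infinity>\<close> at \<open>x0\<close>; the bound \<open>e \<le> u\<^sub>\<infinity>(x0) / 2\<close> keeps it positive nearby.\<close>
  define t where "t = ?u x0 - v x0 - e"
  let ?w = "\<lambda>y. if y \<in> ball x0 s then min (?u y) (v y + t) else ?u y"
  have in0: "ball x0 s \<subseteq> ball x0 r0" using near nr by auto
  have "?w \<in> competitors \<Omega>"
  proof (rule glued_competitor)
    show "infty_superharmonic_on (ball x0 s) (\<lambda>y. v y + t)"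
      by (rule superharmonic_add_const[OF superharmonic_subset[OF v in0]])
    show "ball x0 s \<subseteq> \<Omega>" using in0 r0 by blast
    show "0 < s" by (rule s)
    fix y assume y: "y \<in> ball x0 s"
    then have nd: "dist y x0 < d" using nr by auto
    show "?u y < v y + t" if "s / 2 \<le> dist x0 y"
      using e(3)[of y] y that by (auto simp: A_def t_def)
    show "0 < v y + t" using near[OF nd] e(2) unfolding t_def by linarith
    show "y \<notin> max_dist_set \<Omega>" using near[OF nd] by (auto simp: max_dist_set_def)
    have shift: "subslope (\<lambda>y. v y + t) y = subslope v y" by (simp add: subslope_def)
    have "\<Lambda> * ?u y \<le> c" "y \<in> ball x0 r" using near[OF nd] by auto
    then show "ereal (\<Lambda> * ?u y) \<le> subslope (\<lambda>y. v y + t) y"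
      unfolding shift using slope by (meson ereal_less_eq(3) order_trans)
  qed
  then have "?u x0 \<le> ?w x0" by (rule u_infty_le) (use x0 closure_subset in blast)
  also have "?w x0 < ?u x0" using s e by (simp add: t_def)
  finally show False by simp
qed

lemma u_infty_subsolution: "subsolution \<Lambda> \<Omega> (u_infty \<Omega>)"
  unfolding subsolution_def
proof (intro conjI ballI allI impI)
  show "locally_lipschitz_on \<Omega> (u_infty \<Omega>)"
    using u_infty_supersolution by (simp add: supersolution_def)
  fix x0 r0 v
  assume x0: "x0 \<in> \<Omega>" and r0: "(0::real) < r0" "ball x0 r0 \<subseteq> \<Omega>"
    and v: "infty_superharmonic_on (ball x0 r0) v"
    and touch: "\<forall>\<^sub>F y in at x0. u_infty \<Omega> y - v y < u_infty \<Omega> x0 - v x0"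
  show "Lim (at_right 0) (\<lambda>r. INF x\<in>ball x0 r. subslope v x) \<le> ereal (\<Lambda> * u_infty \<Omega> x0)"
  proof (rule Lim_INF_ball_le)
    fix r :: real assume r: "0 < r"
    show "(INF x\<in>ball x0 r. subslope v x) \<le> ereal (\<Lambda> * u_infty \<Omega> x0)"
    proof (cases "x0 \<in> max_dist_set \<Omega>")
      case True
      have "(INF x\<in>ball x0 r. subslope v x) \<le> subslope v x0" by (rule INF_lower) (use r in simp)
      also have "\<dots> \<le> ereal (\<Lambda> * u_infty \<Omega> x0)"
        using touching_at_max_dist[OF True touch] u_infty_eq_1[OF True] by simp
      finally show ?thesis .
    next
      case False
      show ?thesis by (rule touching_off_max_dist[OF x0 False r0 v touch r])
    qed
  qed
qed

end

theorem theorem1p2: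
  fixes \<Omega> :: "'a::metric_space set"
  assumes geodesic: "\<forall>x y :: 'a. joined_by_geodesic x y"
    and proper: "\<forall>(x :: 'a) r. compact (cball x r)"
    and domain: "open \<Omega>" "connected \<Omega>" "\<Omega> \<noteq> {}"
    and "bounded \<Omega>" and "\<Omega> \<noteq> UNIV"
  shows "continuous_on (closure \<Omega>) (u_infty \<Omega>) \<and>
         solution (Lambda_infty \<Omega>) \<Omega> (u_infty \<Omega>) \<and>
         (\<forall>x\<in>\<Omega>. u_infty \<Omega> x > 0) \<and>
         (\<forall>x\<in>frontier \<Omega>. u_infty \<Omega> x = 0) \<and>
         normalized_on \<Omega> (u_infty \<Omega>)"
proof -
  interpret bounded_domain \<Omega>
    by unfold_locales (use assms in auto)
  show ?thesis
    using u_infty_continuous u_infty_supersolution u_infty_subsolution u_infty_pos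
      u_infty_frontier u_infty_normalized
    by (simp add: solution_def)
qed

end
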